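(* Let $n>1$ be an integer and let $S$ be an $n\times n$ real matrix. Then $S\in \mathrm{Aut}(\mathcal{L}^n_+)$ if and only if there exist a real number $\nu>0$, a real number $\alpha\ge 0$, and orthogonal transformations (orthogonal $(n-1)\times(n-1)$ real matrices) $U, V$ of $\mathbb{R}^{n-1}$ such that $$S=\nu\begin{bmatrix}1&0\\0&V\end{bmatrix}\begin{bmatrix}\sqrt{1+\alpha^2}&\alpha&\mathbf{0}^T\\ \alpha&\sqrt{1+\alpha^2}&\mathbf{0}^T\\ \mathbf{0}&\mathbf{0}&I_{n-2}\end{bmatrix}\begin{bmatrix}1&0\\0&V^T\end{bmatrix}\begin{bmatrix}1&0\\0&U\end{bmatrix}.$$
   Context: Elements of $\mathbb{R}^n$ ($n>1$) are written as $x=\begin{bmatrix}x_0\\ \overline{x}\end{bmatrix}$ with $x_0\in\mathbb{R}$ and $\overline{x}\in\mathbb{R}^{n-1}$, and $\|\cdot\|$ is the Euclidean norm. The Lorentz cone (second-order cone) is $\mathcal{L}^n_+=\{x\in\mathbb{R}^n:\|\overline{x}\|\le x_0\}$. $\mathrm{Aut}(\mathcal{L}^n_+)$ denotes the set of cone automorphisms, i.e. linear transformations $S:\mathbb{R}^n\to\mathbb{R}^n$ (identified with $n\times n$ real matrices) satisfying $S(\mathcal{L}^n_+)=\mathcal{L}^n_+$. In the displayed formula, the matrices containing $U$, $V$, $V^T$ are $n\times n$ block diagonal with blocks of sizes $1$ and $n-1$; in the second factor, $\mathbf{0}$ is the zero column vector in $\mathbb{R}^{n-2}$ and $I_{n-2}$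 is the $(n-2)\times(n-2)$ identity matrix (when $n=2$ the last block row and column are absent). *)

theory Defs
  imports "HOL-Analysis.L2_Norm" "Jordan_Normal_Form.Matrix"
begin

definition eucl_norm_vec :: "real vec \<Rightarrow> real" where
  "eucl_norm_vec x = L2_set (\<lambda>i. x $ i) {..<dim_vec x}"

definition lorentz_cone :: "nat \<Rightarrow> real vec set" where
  "lorentz_cone n = {x \<in> carrier_vec n. eucl_norm_vec (vec_last x (n - 1)) \<le> x $ 0}"

definition cone_automorphisms :: "nat \<Rightarrow> real vec set \<Rightarrow> real mat set" where
  "cone_automorphisms n K = {S \<in> carrier_mat n n. (\<lambda>x. S *\<^sub>v x) ` K = K}"

text \<open>The library's \<^const>\<open>orthogonal_mat\<close> only asks the columns to be pairwise
  orthogonal and nonzero; here they have to be orthonormal.\<close>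

definition orthogonal_group :: "nat \<Rightarrow> real mat set" where
  "orthogonal_group m =
     {U \<in> carrier_mat m m. transpose_mat U * U = 1\<^sub>m m \<and> U * transpose_mat U = 1\<^sub>m m}"

text \<open>For \<open>n = 2\<close> the identity block is the empty matrix \<open>1\<^sub>m 0\<close>.\<close>

definition lorentz_boost :: "nat \<Rightarrow> real \<Rightarrow> real mat" where
  "lorentz_boost n \<alpha> =
     diag_block_mat
       [mat_of_rows_list 2 [[sqrt (1 + \<alpha>\<^sup>2), \<alpha>], [\<alpha>, sqrt (1 + \<alpha>\<^sup>2)]], 1\<^sub>m (n - 2)]"

end

theory Submission
  imports Defs "Jordan_Normal_Form.Determinant"
begin

text \<open>
  Write \<open>n = Suc m\<close>, let \<open>\<eta> = diag(1, -1, \<dots>, -1)\<close> be the Minkowski matrix and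
  \<open>q x = x \<bullet> \<eta> x\<close>. The Lorentz cone is the set of \<open>x\<close> with \<open>x\<^sub>0 \<ge> 0\<close> and \<open>q x \<ge> 0\<close>, and the
  theorem says that its automorphisms are the positive multiples of orthochronous Lorentz
  matrices, each of which is an orthogonal transformation of space followed by a boost.

  The substance is that an automorphism \<open>S\<close> scales \<open>q\<close>. Interior points of the cone can be told
  from boundary points by linear means: \<open>x\<close> is interior iff in every direction one can move a
  little from \<open>x\<close> and remain in the cone. Hence \<open>S\<close> and its inverse preserve the interior, \<open>S\<close>
  maps null vectors (\<open>q x = 0\<close>) to null vectors (\<open>automorphism_preserves_null\<close>), and the symmetric
  matrix \<open>S\<^sup>T \<eta> S\<close> has a quadratic form vanishing on the light cone. Evaluating it at a few null
  vectors with rational entries shows that it is \<open>\<mu> \<eta>\<close> (\<open>symmetric_vanishing_on_null_cone\<close>); the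
  number \<open>\<mu>\<close> is \<open>q\<close> of the image of the time axis, hence positive, and \<open>S / sqrt \<mu>\<close> is an
  orthochronous Lorentz matrix. Conversely such matrices preserve \<open>q\<close>, and they preserve the sign
  of \<open>x\<^sub>0\<close> because their first row lies in the cone, which is self-dual; they form a group, so they
  map the cone onto itself.

  To decompose an orthochronous \<open>L\<close>, let \<open>(a, b)\<close> be its first column, so \<open>a\<^sup>2 - b \<bullet> b = 1\<close>. With
  \<open>\<alpha>\<close> the length of \<open>b\<close> and \<open>V\<close> an orthogonal matrix (a Householder reflection or the identity)
  that turns the first spatial axis into the direction of \<open>b\<close>, the boost conjugated by \<open>diag(1, V)\<close> has the same
  first column. Dividing it out leaves a Lorentz matrix that fixes the time axis, and such a matrix
  is \<open>diag(1, U)\<close> with \<open>U\<close> orthogonal.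
\<close>

section \<open>Linear maps that fix the time axis\<close>

definition spatial_block :: "nat \<Rightarrow> real mat \<Rightarrow> real mat" where
  "spatial_block m A = four_block_mat (1\<^sub>m 1) (0\<^sub>m 1 m) (0\<^sub>m m 1) A"

lemma spatial_block_carrier [simp]:
  "A \<in> carrier_mat m m \<Longrightarrow> spatial_block m A \<in> carrier_mat (Suc m) (Suc m)"
  by (auto simp: spatial_block_def)

lemma spatial_block_mult:
  assumes "A \<in> carrier_mat m m" "B \<in> carrier_mat m m"
  shows "spatial_block m A * spatial_block m B = spatial_block m (A * B)"
  unfolding spatial_block_def
  by (subst mult_four_block_mat[of _ 1 1 _ m _ m _ _ 1 _ m]) (use assms in auto)

lemma spatial_block_transpose:
  assumes "A \<in> carrier_mat m m"
  shows "transpose_mat (spatial_block m A) = spatial_block m (transpose_mat A)"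
  unfolding spatial_block_def
  by (subst transpose_four_block_mat[of _ 1 1 _ m _ m]) (use assms in auto)

lemma spatial_block_one: "spatial_block m (1\<^sub>m m) = 1\<^sub>m (Suc m)"
  unfolding spatial_block_def by simp

lemma spatial_block_index:
  assumes "A \<in> carrier_mat m m"
  shows "spatial_block m A $$ (0, 0) = 1"
    "j < m \<Longrightarrow> spatial_block m A $$ (0, Suc j) = 0"
    "i < m \<Longrightarrow> spatial_block m A $$ (Suc i, 0) = 0"
    "i < m \<Longrightarrow> j < m \<Longrightarrow> spatial_block m A $$ (Suc i, Suc j) = A $$ (i, j)"
  using assms by (auto simp: spatial_block_def)

lemma spatial_block_inject:
  assumes "A \<in> carrier_mat m m" "B \<in> carrier_mat m m" "spatial_block m A = spatial_block m B"
  shows "A = B"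
  using assms spatial_block_index(4)[of A m] spatial_block_index(4)[of B m]
  by (intro eq_matI) (auto simp del: One_nat_def)

lemma diag_block_mat_pair:
  "diag_block_mat [A, B] =
    four_block_mat A (0\<^sub>m (dim_row A) (dim_col B)) (0\<^sub>m (dim_row B) (dim_col A)) B"
proof -
  have "four_block_mat B (0\<^sub>m (dim_row B) 0) (0\<^sub>m 0 (dim_col B)) (0\<^sub>m 0 0) = B"
    by (intro eq_matI) auto
  then show ?thesis
    by (simp add: Let_def)
qed

lemma diag_block_mat_eq_spatial_block:
  assumes "A \<in> carrier_mat m m"
  shows "diag_block_mat [1\<^sub>m 1, A] = spatial_block m A"
  using assms by (simp only: diag_block_mat_pair spatial_block_def carrier_matD index_one_mat)

lemma spatial_block_mult_vec:
  assumes "A \<in> carrier_mat m m" "x \<in> carrier_vec m"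
  shows "spatial_block m A *\<^sub>v vCons a x = vCons a (A *\<^sub>v x)"
proof -
  have eq: "vCons c y = vec 1 (\<lambda>_. c) @\<^sub>v y" for c and y :: "real vec"
    by (rule eq_vecI) (auto simp: vec_index_vCons)
  show ?thesis
    unfolding eq spatial_block_def
    by (subst mult_mat_vec_split[of _ 1 _ m]) (use assms in auto)
qed

section \<open>The Minkowski form and the Lorentz cone\<close>

definition minkowski :: "nat \<Rightarrow> real mat" where
  "minkowski m = spatial_block m (- 1\<^sub>m m)"

lemma minkowski_carrier [simp]: "minkowski m \<in> carrier_mat (Suc m) (Suc m)"
  by (simp add: minkowski_def)

lemma minkowski_transpose: "transpose_mat (minkowski m) = minkowski m"
  by (simp add: minkowski_def spatial_block_transpose transpose_uminus)

lemma minkowski_involution: "minkowski m * minkowski m = 1\<^sub>m (Suc m)"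
proof -
  have "- 1\<^sub>m m * - 1\<^sub>m m = (1\<^sub>m m :: real mat)"
    by (subst uminus_mult_left_mat) (auto)
  then show ?thesis
    by (simp add: minkowski_def spatial_block_mult spatial_block_one)
qed

definition minkowski_form :: "nat \<Rightarrow> real vec \<Rightarrow> real" where
  "minkowski_form m x = x \<bullet> (minkowski m *\<^sub>v x)"

lemma minkowski_form_smult:
  assumes "x \<in> carrier_vec (Suc m)"
  shows "minkowski_form m (c \<cdot>\<^sub>v x) = c\<^sup>2 * minkowski_form m x"
proof -
  have "minkowski m *\<^sub>v x \<in> carrier_vec (Suc m)"
    using assms by (intro mult_mat_vec_carrier[of _ _ "Suc m"]) auto
  then show ?thesis
    using assms by (simp add: minkowski_form_def mult_mat_vec[of _ "Suc m" "Suc m"] power2_eq_square)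
qed

lemma minkowski_form_vCons:
  assumes "x \<in> carrier_vec m"
  shows "minkowski_form m (vCons a x) = a\<^sup>2 - x \<bullet> x"
  unfolding minkowski_form_def minkowski_def
  using assms by (subst spatial_block_mult_vec) (auto simp: power2_eq_square)

lemma scalar_prod_self_eq_sum: "x \<in> carrier_vec m \<Longrightarrow> x \<bullet> x = (\<Sum>i<m. (x $ i)\<^sup>2)" for x :: "real vec"
  by (auto simp: scalar_prod_def power2_eq_square atLeast0LessThan)

lemma vCons_cases_carrier:
  assumes "x \<in> carrier_vec (Suc m)"
  obtains a y where "x = vCons a y" "y \<in> carrier_vec m"
  using assms by (metis vec_Suc carrier_vecI carrier_vecD vec_carrier vec_eq_iff dim_vec eq_vecI index_vec)

lemma minkowski_form_eq:
  assumes "x \<in> carrier_vec (Suc m)"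
  shows "minkowski_form m x = (x $ 0)\<^sup>2 - (\<Sum>i<m. (x $ Suc i)\<^sup>2)"
  using assms by (elim vCons_cases_carrier) (simp add: minkowski_form_vCons scalar_prod_self_eq_sum)

lemma lorentz_cone_iff:
  assumes "m > 0"
  shows "x \<in> lorentz_cone (Suc m) \<longleftrightarrow>
    x \<in> carrier_vec (Suc m) \<and> 0 \<le> x $ 0 \<and> 0 \<le> minkowski_form m x"
proof (cases "x \<in> carrier_vec (Suc m)")
  case True
  have "eucl_norm_vec (vec_last x m) = sqrt (\<Sum>i<m. (x $ Suc i)\<^sup>2)"
    using True by (auto simp: eucl_norm_vec_def L2_set_def vec_last_def)
  moreover have "sqrt s \<le> a \<longleftrightarrow> 0 \<le> a \<and> s \<le> a\<^sup>2" if "s \<ge> 0" for s a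
    using that by (metis real_sqrt_ge_zero order_trans real_le_lsqrt sqrt_le_D)
  ultimately show ?thesis
    using True by (auto simp: lorentz_cone_def minkowski_form_eq sum_nonneg)
qed (simp add: lorentz_cone_def)

lemma lorentz_cone_smult:
  assumes "m > 0" "x \<in> lorentz_cone (Suc m)" "c \<ge> 0"
  shows "c \<cdot>\<^sub>v x \<in> lorentz_cone (Suc m)"
  using assms by (auto simp: lorentz_cone_iff minkowski_form_smult)

text \<open>One half of the self-duality of the cone: by Cauchy-Schwarz the spatial part of \<open>x \<bullet> y\<close> is at
  most \<open>x\<^sub>0 y\<^sub>0\<close> in absolute value.\<close>
lemma lorentz_cone_dual:
  assumes "m > 0" "x \<in> lorentz_cone (Suc m)" "y \<in> lorentz_cone (Suc m)"
  shows "0 \<le> x \<bullet> y"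
proof -
  from assms have xy: "x \<in> carrier_vec (Suc m)" "y \<in> carrier_vec (Suc m)"
    "0 \<le> x $ 0" "0 \<le> y $ 0"
    and *: "(\<Sum>i<m. (x $ Suc i)\<^sup>2) \<le> (x $ 0)\<^sup>2" "(\<Sum>i<m. (y $ Suc i)\<^sup>2) \<le> (y $ 0)\<^sup>2"
    by (auto simp: lorentz_cone_iff minkowski_form_eq)
  let ?s = "\<Sum>i<m. x $ Suc i * y $ Suc i"
  have "\<bar>?s\<bar> \<le> (\<Sum>i<m. \<bar>x $ Suc i\<bar> * \<bar>y $ Suc i\<bar>)"
    by (rule order_trans[OF sum_abs]) (simp add: abs_mult)
  also have "\<dots> \<le> L2_set (\<lambda>i. x $ Suc i) {..<m} * L2_set (\<lambda>i. y $ Suc i) {..<m}"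
    by (rule L2_set_mult_ineq)
  also have "\<dots> \<le> x $ 0 * y $ 0"
    using * xy by (intro mult_mono) (auto simp: L2_set_def intro: real_le_lsqrt sum_nonneg)
  finally have "\<bar>?s\<bar> \<le> x $ 0 * y $ 0" .
  moreover have "x \<bullet> y = x $ 0 * y $ 0 + ?s"
    using xy by (simp add: scalar_prod_def atLeast0LessThan sum.lessThan_Suc_shift del: sum.lessThan_Suc)
  ultimately show ?thesis by linarith
qed

text \<open>This lemma and the next characterise the points with \<open>q > 0\<close> among the points of the cone
  in terms of the linear structure alone, which is what makes the notion invariant under
  automorphisms. Here the point is continuity of \<open>q\<close> and of the time coordinate along a line.\<close>
lemma interior_small_step:
  assumes m: "m > 0" and x: "x \<in> lorentz_cone (Suc m)" "minkowski_form m x > 0"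
    and z: "z \<in> carrier_vec (Suc m)"
  shows "\<exists>t>0. x - t \<cdot>\<^sub>v z \<in> lorentz_cone (Suc m)"
proof -
  let ?f = "\<lambda>t. (x $ 0 - t * z $ 0)\<^sup>2 - (\<Sum>i<m. (x $ Suc i - t * z $ Suc i)\<^sup>2)"
  let ?g = "\<lambda>t. x $ 0 - t * z $ 0"
  have xc: "x \<in> carrier_vec (Suc m)" "0 \<le> x $ 0" using x m by (auto simp: lorentz_cone_iff)
  have f0: "?f 0 > 0" using x(2) xc by (simp add: minkowski_form_eq)
  have "(\<Sum>i<m. (x $ Suc i)\<^sup>2) \<ge> 0" by (simp add: sum_nonneg)
  with f0 have "x $ 0 \<noteq> 0" by auto
  with xc have g0: "?g 0 > 0" by simp
  have "(?f \<longlongrightarrow> ?f 0) (at_right 0)" "(?g \<longlongrightarrow> ?g 0) (at_right 0)"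
    by (intro tendsto_intros)+
  then have "\<forall>\<^sub>F t in at_right 0. ?f t > 0" "\<forall>\<^sub>F t in at_right 0. ?g t > 0"
    using f0 g0 by (auto dest: order_tendstoD(1) simp del: diff_gt_0_iff_gt mult_zero_left)
  moreover have "\<forall>\<^sub>F t in at_right (0::real). t > 0" by (rule eventually_at_right_less)
  ultimately have "\<forall>\<^sub>F t in at_right 0. t > 0 \<and> ?f t > 0 \<and> ?g t > 0"
    by eventually_elim auto
  then obtain t where "t > 0" "?f t > 0" "?g t > 0"
    using eventually_happens trivial_limit_at_right_real by blast
  moreover have "minkowski_form m (x - t \<cdot>\<^sub>v z) = ?f t"
    using xc z by (subst minkowski_form_eq) auto
  ultimately show ?thesis
    using xc z m by (intro exI[of _ t]) (auto simp: lorentz_cone_iff)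
qed

text \<open>A single test direction detects the interior: going down along the time axis shrinks the
  time coordinate and keeps the spatial part, so it leaves the cone at once when \<open>q x = 0\<close>.\<close>
lemma minkowski_form_pos_of_minus_axis:
  assumes "m > 0" "x \<in> carrier_vec (Suc m)" "t > 0"
    and "x - t \<cdot>\<^sub>v unit_vec (Suc m) 0 \<in> lorentz_cone (Suc m)"
  shows "minkowski_form m x > 0"
proof -
  from assms have *: "0 \<le> x $ 0 - t" "(\<Sum>i<m. (x $ Suc i)\<^sup>2) \<le> (x $ 0 - t)\<^sup>2"
    by (auto simp: lorentz_cone_iff minkowski_form_eq)
  have "(x $ 0 - t)\<^sup>2 < (x $ 0)\<^sup>2"
    using * assms(3) by (intro power_strict_mono) auto
  with * assms show ?thesis by (simp add: minkowski_form_eq)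
qed

section \<open>The orthochronous Lorentz group\<close>

abbreviation time_axis :: "nat \<Rightarrow> real vec" where
  "time_axis m \<equiv> unit_vec (Suc m) 0"

lemma time_axis_eq_vCons: "time_axis m = vCons 1 (0\<^sub>v m)"
  by (rule eq_vecI) (auto simp: vec_index_vCons unit_vec_def)

lemma spatial_block_time_axis:
  "A \<in> carrier_mat m m \<Longrightarrow> spatial_block m A *\<^sub>v time_axis m = time_axis m"
  by (auto simp: time_axis_eq_vCons spatial_block_mult_vec intro!: eq_vecI)

lemma minkowski_form_time_axis: "minkowski_form m (time_axis m) = 1"
  by (simp add: time_axis_eq_vCons minkowski_form_vCons)

lemma time_axis_in_lorentz_cone: "m > 0 \<Longrightarrow> time_axis m \<in> lorentz_cone (Suc m)"
  by (simp add: lorentz_cone_iff minkowski_form_time_axis)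

lemma mult_unit_vec_index:
  assumes "A \<in> carrier_mat n n" "i < n" "j < n"
  shows "(A *\<^sub>v unit_vec n j) $ i = (A $$ (i, j) :: real)"
  using assms by simp

text \<open>The form pulled back along \<open>S\<close> is the quadratic form of the matrix \<open>S\<^sup>T \<eta> S\<close>; scaling of the
  form by \<open>S\<close> thus becomes a matrix equation.\<close>
lemma minkowski_form_mult:
  assumes "S \<in> carrier_mat (Suc m) (Suc m)" "x \<in> carrier_vec (Suc m)"
  shows "minkowski_form m (S *\<^sub>v x) = x \<bullet> ((transpose_mat S * minkowski m * S) *\<^sub>v x)"
proof -
  have c: "minkowski m *\<^sub>v (S *\<^sub>v x) \<in> carrier_vec (Suc m)"
    using assms by (intro mult_mat_vec_carrier[of _ _ "Suc m"]) auto
  have "minkowski_form m (S *\<^sub>v x) = (minkowski m *\<^sub>v (S *\<^sub>v x)) \<bullet> (S *\<^sub>v x)"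
    unfolding minkowski_form_def using assms c
    by (intro comm_scalar_prod[of _ "Suc m"]) auto
  also have "\<dots> = (transpose_mat S *\<^sub>v (minkowski m *\<^sub>v (S *\<^sub>v x))) \<bullet> x"
    using assms c by (intro transpose_vec_mult_scalar[symmetric]) auto
  also have "\<dots> = x \<bullet> (transpose_mat S *\<^sub>v (minkowski m *\<^sub>v (S *\<^sub>v x)))"
    using assms c by (intro comm_scalar_prod[of _ "Suc m"]) auto
  also have "transpose_mat S *\<^sub>v (minkowski m *\<^sub>v (S *\<^sub>v x))
      = (transpose_mat S * minkowski m * S) *\<^sub>v x"
    using assms by (subst assoc_mult_mat_vec[of _ "Suc m" "Suc m" _ "Suc m"], auto)+
  finally show ?thesis .
qed

definition lorentz_group :: "nat \<Rightarrow> real mat set" where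
  "lorentz_group m =
     {L \<in> carrier_mat (Suc m) (Suc m). transpose_mat L * minkowski m * L = minkowski m}"

lemma lorentz_group_carrier: "L \<in> lorentz_group m \<Longrightarrow> L \<in> carrier_mat (Suc m) (Suc m)"
  by (simp add: lorentz_group_def)

lemma minkowski_form_lorentz:
  assumes "L \<in> lorentz_group m" "x \<in> carrier_vec (Suc m)"
  shows "minkowski_form m (L *\<^sub>v x) = minkowski_form m x"
  using minkowski_form_mult[OF lorentz_group_carrier[OF assms(1)] assms(2)] assms(1)
  by (simp only: lorentz_group_def minkowski_form_def mem_Collect_eq)

text \<open>Since \<open>\<eta>\<^sup>2 = 1\<close>, the equation \<open>L\<^sup>T \<eta> L = \<eta>\<close> says that \<open>\<eta> L\<^sup>T \<eta>\<close> is a left inverse of \<open>L\<close>.\<close>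
definition lorentz_inverse :: "nat \<Rightarrow> real mat \<Rightarrow> real mat" where
  "lorentz_inverse m L = minkowski m * transpose_mat L * minkowski m"

lemma lorentz_inverse_carrier:
  "L \<in> carrier_mat (Suc m) (Suc m) \<Longrightarrow> lorentz_inverse m L \<in> carrier_mat (Suc m) (Suc m)"
  unfolding lorentz_inverse_def by (intro mult_carrier_mat[of _ _ "Suc m"]) auto

lemma lorentz_inverse_mult:
  assumes L: "L \<in> lorentz_group m"
  shows "lorentz_inverse m L * L = 1\<^sub>m (Suc m)" "L * lorentz_inverse m L = 1\<^sub>m (Suc m)"
proof -
  note [simp] = lorentz_group_carrier[OF L]
  have "lorentz_inverse m L * L = minkowski m * (transpose_mat L * minkowski m * L)"
    unfolding lorentz_inverse_def
    by (simp add: assoc_mult_mat[of _ "Suc m" "Suc m" _ "Suc m" _ "Suc m"]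
        mult_carrier_mat[of _ "Suc m" "Suc m"])
  also have "\<dots> = 1\<^sub>m (Suc m)"
    using L by (simp add: lorentz_group_def minkowski_involution)
  finally show "lorentz_inverse m L * L = 1\<^sub>m (Suc m)" .
  then show "L * lorentz_inverse m L = 1\<^sub>m (Suc m)"
    using lorentz_inverse_carrier[OF lorentz_group_carrier[OF L]] lorentz_group_carrier[OF L]
    by (rule mat_mult_left_right_inverse[rotated 2])
qed

text \<open>The left inverse \<open>\<eta> L\<^sup>T \<eta>\<close> is also a right inverse, and \<open>L (\<eta> L\<^sup>T \<eta>) = 1\<close> multiplied by \<open>\<eta>\<close>
  on the right is the defining equation for the transpose.\<close>
lemma lorentz_group_transpose:
  assumes L: "L \<in> lorentz_group m"
  shows "transpose_mat L \<in> lorentz_group m"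
proof -
  note [simp] = lorentz_group_carrier[OF L]
  note assoc = assoc_mult_mat[of _ "Suc m" "Suc m" _ "Suc m" _ "Suc m"]
    mult_carrier_mat[of _ "Suc m" "Suc m"]
  have "L * minkowski m * transpose_mat L
      = L * minkowski m * transpose_mat L * (minkowski m * minkowski m)"
    by (simp add: minkowski_involution assoc right_mult_one_mat[of _ "Suc m" "Suc m"])
  also have "\<dots> = L * lorentz_inverse m L * minkowski m"
    unfolding lorentz_inverse_def by (simp add: assoc)
  also have "\<dots> = minkowski m"
    by (simp add: lorentz_inverse_mult[OF L] left_mult_one_mat[OF minkowski_carrier])
  finally show ?thesis
    by (simp add: lorentz_group_def)
qed

lemma lorentz_group_mult:
  assumes "L \<in> lorentz_group m" "K \<in> lorentz_group m"
  shows "L * K \<in> lorentz_group m"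
proof -
  note [simp] = assms[THEN lorentz_group_carrier]
  note assoc = assoc_mult_mat[of _ "Suc m" "Suc m" _ "Suc m" _ "Suc m"]
    mult_carrier_mat[of _ "Suc m" "Suc m"]
  have "transpose_mat (L * K) * minkowski m * (L * K)
      = transpose_mat K * (transpose_mat L * minkowski m * L) * K"
    by (simp add: transpose_mult[of _ "Suc m" "Suc m" _ "Suc m"] assoc)
  then show ?thesis
    using assms by (simp add: lorentz_group_def mult_carrier_mat[of _ "Suc m" "Suc m"])
qed

lemma minkowski_in_lorentz_group: "minkowski m \<in> lorentz_group m"
  by (simp add: lorentz_group_def minkowski_transpose minkowski_involution
      left_mult_one_mat[OF minkowski_carrier])

lemma lorentz_group_inverse:
  "L \<in> lorentz_group m \<Longrightarrow> lorentz_inverse m L \<in> lorentz_group m"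
  unfolding lorentz_inverse_def
  by (intro lorentz_group_mult lorentz_group_transpose minkowski_in_lorentz_group)

text \<open>Orthochronous means that the future is not exchanged with the past. Asking this for the time
  axis gives closure under products as soon as such matrices are known to map the cone into itself;
  the usual condition on the top left entry (\<open>orthochronous_iff\<close>) gives closure under transposition.\<close>
definition orthochronous :: "nat \<Rightarrow> real mat set" where
  "orthochronous m = {L \<in> lorentz_group m. L *\<^sub>v time_axis m \<in> lorentz_cone (Suc m)}"

lemma orthochronous_iff:
  assumes "m > 0" "L \<in> lorentz_group m"
  shows "L \<in> orthochronous m \<longleftrightarrow> 0 \<le> L $$ (0, 0)"
  using assms lorentz_group_carrier[OF assms(2)]
  by (simp add: orthochronous_def lorentz_cone_iff minkowski_form_lorentz minkowski_form_time_axis)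

lemma orthochronous_transpose:
  assumes "m > 0" "L \<in> orthochronous m"
  shows "transpose_mat L \<in> orthochronous m"
proof -
  from assms(2) have L: "L \<in> lorentz_group m" by (simp add: orthochronous_def)
  from lorentz_group_carrier[OF L] have "transpose_mat L $$ (0, 0) = L $$ (0, 0)" by simp
  with assms L lorentz_group_transpose[OF L] show ?thesis by (simp add: orthochronous_iff)
qed

text \<open>The sign of the time coordinate of \<open>L x\<close> is the only issue. That coordinate is the scalar
  product of \<open>x\<close> with the first row of \<open>L\<close>, and the first row is the image of the time axis
  under the transpose of \<open>L\<close>, so self-duality of the cone applies.\<close>
lemma orthochronous_lorentz_cone:
  assumes m: "m > 0" and L: "L \<in> orthochronous m" and x: "x \<in> lorentz_cone (Suc m)"
  shows "L *\<^sub>v x \<in> lorentz_cone (Suc m)"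
proof -
  from L have LG: "L \<in> lorentz_group m" by (simp add: orthochronous_def)
  note Lc = lorentz_group_carrier[OF LG]
  from x m have xc: "x \<in> carrier_vec (Suc m)" "minkowski_form m x \<ge> 0"
    by (auto simp: lorentz_cone_iff)
  have "transpose_mat L *\<^sub>v time_axis m \<in> lorentz_cone (Suc m)"
    using orthochronous_transpose[OF m L] by (simp add: orthochronous_def)
  then have "0 \<le> (transpose_mat L *\<^sub>v time_axis m) \<bullet> x"
    using m x by (intro lorentz_cone_dual)
  also have "\<dots> = time_axis m \<bullet> (L *\<^sub>v x)"
    by (rule transpose_vec_mult_scalar) (use Lc xc in auto)
  also have "\<dots> = (L *\<^sub>v x) $ 0"
    using Lc xc by (intro scalar_prod_left_unit) auto
  finally show ?thesis
    using m xc Lc minkowski_form_lorentz[OF LG xc(1)] by (simp add: lorentz_cone_iff)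
qed

lemma orthochronous_mult:
  assumes "m > 0" "L \<in> orthochronous m" "K \<in> orthochronous m"
  shows "L * K \<in> orthochronous m"
proof -
  from assms have *: "L \<in> lorentz_group m" "K \<in> lorentz_group m"
    by (auto simp: orthochronous_def)
  have "(L * K) *\<^sub>v time_axis m = L *\<^sub>v (K *\<^sub>v time_axis m)"
    using *[THEN lorentz_group_carrier] by (intro assoc_mult_mat_vec) auto
  moreover have "L *\<^sub>v (K *\<^sub>v time_axis m) \<in> lorentz_cone (Suc m)"
    using assms by (intro orthochronous_lorentz_cone time_axis_in_lorentz_cone)
  ultimately show ?thesis
    using * by (simp only: orthochronous_def lorentz_group_mult mem_Collect_eq)
qed

lemma minkowski_orthochronous: "m > 0 \<Longrightarrow> minkowski m \<in> orthochronous m"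
  using minkowski_in_lorentz_group[of m] spatial_block_index(1)[of "- 1\<^sub>m m" m]
  by (simp add: orthochronous_iff minkowski_def)

lemma orthochronous_inverse:
  "m > 0 \<Longrightarrow> L \<in> orthochronous m \<Longrightarrow> lorentz_inverse m L \<in> orthochronous m"
  unfolding lorentz_inverse_def
  by (intro orthochronous_mult orthochronous_transpose minkowski_orthochronous)

text \<open>The image of the cone is all of the cone because the inverse of \<open>L\<close> is orthochronous as well.\<close>
lemma smult_orthochronous_automorphism:
  assumes m: "m > 0" and L: "L \<in> orthochronous m" and nu: "\<nu> > 0"
  shows "\<nu> \<cdot>\<^sub>m L \<in> cone_automorphisms (Suc m) (lorentz_cone (Suc m))"
proof -
  from L have LG: "L \<in> lorentz_group m" by (simp add: orthochronous_def)
  note Lc = lorentz_group_carrier[OF LG]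
  have sm: "(\<nu> \<cdot>\<^sub>m L) *\<^sub>v x = \<nu> \<cdot>\<^sub>v (L *\<^sub>v x)" if "x \<in> carrier_vec (Suc m)" for x
    using Lc that by (intro eq_vecI) auto
  have "(\<lambda>x. (\<nu> \<cdot>\<^sub>m L) *\<^sub>v x) ` lorentz_cone (Suc m) = lorentz_cone (Suc m)"
  proof (intro equalityI subsetI)
    fix y assume "y \<in> (\<lambda>x. (\<nu> \<cdot>\<^sub>m L) *\<^sub>v x) ` lorentz_cone (Suc m)"
    then show "y \<in> lorentz_cone (Suc m)"
      using m L nu sm by (auto simp: lorentz_cone_iff[of m, THEN iffD1]
          intro!: lorentz_cone_smult orthochronous_lorentz_cone)
  next
    fix y assume y: "y \<in> lorentz_cone (Suc m)"
    then have yc: "y \<in> carrier_vec (Suc m)" by (simp add: lorentz_cone_def)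
    let ?x = "(1 / \<nu>) \<cdot>\<^sub>v (lorentz_inverse m L *\<^sub>v y)"
    have x: "?x \<in> lorentz_cone (Suc m)"
      using m L nu y by (intro lorentz_cone_smult orthochronous_lorentz_cone orthochronous_inverse) auto
    have iy: "lorentz_inverse m L *\<^sub>v y \<in> carrier_vec (Suc m)"
      using lorentz_inverse_carrier[OF Lc] yc by auto
    have "L *\<^sub>v (lorentz_inverse m L *\<^sub>v y) = y"
      using yc Lc lorentz_inverse_carrier[OF Lc] lorentz_inverse_mult(2)[OF LG]
      by (simp flip: assoc_mult_mat_vec)
    then have "(\<nu> \<cdot>\<^sub>m L) *\<^sub>v ?x = y"
      using nu iy by (simp add: sm mult_mat_vec[OF Lc] smult_smult_assoc)
    then show "y \<in> (\<lambda>x. (\<nu> \<cdot>\<^sub>m L) *\<^sub>v x) ` lorentz_cone (Suc m)"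
      by (intro rev_image_eqI[OF x]) simp
  qed
  with Lc show ?thesis by (simp add: cone_automorphisms_def)
qed

section \<open>Automorphisms of the cone scale the Minkowski form\<close>

text \<open>\<open>S\<close> is onto because the cone spans the space: a unit vector \<open>e\<^sub>i\<close> is the difference of
  \<open>e\<^sub>0 + e\<^sub>i\<close> and \<open>e\<^sub>0\<close>, both of which lie in the cone and hence have preimages.\<close>
lemma automorphism_inverse:
  assumes m: "m > 0" and S: "S \<in> cone_automorphisms (Suc m) (lorentz_cone (Suc m))"
  obtains R where "R \<in> cone_automorphisms (Suc m) (lorentz_cone (Suc m))"
    and "R * S = 1\<^sub>m (Suc m)"
proof -
  let ?C = "lorentz_cone (Suc m)"
  from S have Sc: "S \<in> carrier_mat (Suc m) (Suc m)"
    and SC: "(\<lambda>x. S *\<^sub>v x) ` ?C = ?C"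
    by (auto simp: cone_automorphisms_def)
  have carr: "x \<in> carrier_vec (Suc m)" if "x \<in> ?C" for x
    using that by (simp add: lorentz_cone_def)
  have e0: "time_axis m \<in> ?C" using m by (rule time_axis_in_lorentz_cone)
  have "\<exists>r \<in> carrier_vec (Suc m). S *\<^sub>v r = unit_vec (Suc m) i" if i: "i < Suc m" for i
  proof -
    have "time_axis m + unit_vec (Suc m) i \<in> ?C"
    proof -
      have "(\<Sum>j<m. ((time_axis m + unit_vec (Suc m) i) $ Suc j)\<^sup>2) \<le>
          (\<Sum>j<m. if Suc j = i then 1 else 0)"
        using i by (intro sum_mono) (auto simp: unit_vec_def)
      also have "\<dots> \<le> (\<Sum>j\<in>{i - 1}. 1)"
        by (subst sum.If_cases) (auto intro!: card_mono[of "{i - 1}", simplified])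
      also have "\<dots> \<le> ((time_axis m + unit_vec (Suc m) i) $ 0)\<^sup>2"
        using i by (auto simp: unit_vec_def)
      finally show ?thesis
        using m i by (auto simp: lorentz_cone_iff minkowski_form_eq unit_vec_def)
    qed
    then obtain u where u: "u \<in> ?C" "S *\<^sub>v u = time_axis m + unit_vec (Suc m) i"
      using SC by (metis (no_types, lifting) imageE)
    from e0 obtain v where v: "v \<in> ?C" "S *\<^sub>v v = time_axis m"
      using SC by (metis (no_types, lifting) imageE)
    have "S *\<^sub>v (u - v) = unit_vec (Suc m) i"
      using u v carr Sc by (simp add: mult_minus_distrib_mat_vec[of _ "Suc m" "Suc m"]) (auto intro!: eq_vecI)
    with carr[OF u(1)] carr[OF v(1)] show ?thesis
      by (intro bexI[of _ "u - v"]) auto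
  qed
  then obtain r where r: "r i \<in> carrier_vec (Suc m)" "S *\<^sub>v r i = unit_vec (Suc m) i"
    if "i < Suc m" for i by metis
  define R where "R = mat_of_cols (Suc m) (map r [0..<Suc m])"
  have Rc: "R \<in> carrier_mat (Suc m) (Suc m)"
    using mat_of_cols_carrier(1)[of "Suc m" "map r [0..<Suc m]"]
    by (simp only: R_def length_map length_upt diff_zero)
  have "col (S * R) i = col (1\<^sub>m (Suc m)) i" if "i < Suc m" for i
  proof -
    have "col R i = r i"
      using that r(1)[OF that] by (simp add: R_def col_mat_of_cols del: upt_Suc)
    with r(2)[OF that] that show ?thesis
      by (simp add: col_mult2[OF Sc Rc])
  qed
  then have "S * R = 1\<^sub>m (Suc m)"
    using Sc Rc by (intro mat_col_eqI) auto
  then have RS: "R * S = 1\<^sub>m (Suc m)"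
    using mat_mult_left_right_inverse[OF Sc Rc] by simp
  have "(\<lambda>x. R *\<^sub>v x) ` ?C = (\<lambda>x. R *\<^sub>v (S *\<^sub>v x)) ` ?C"
    by (subst SC[symmetric]) (simp only: image_image)
  also have "\<dots> = (\<lambda>x. x) ` ?C"
  proof (intro image_cong refl)
    fix x assume "x \<in> ?C"
    with carr[of x] show "R *\<^sub>v (S *\<^sub>v x) = x"
      by (simp add: RS flip: assoc_mult_mat_vec[OF Rc Sc])
  qed
  finally have "R \<in> cone_automorphisms (Suc m) ?C"
    using Rc by (simp add: cone_automorphisms_def)
  with RS show thesis by (rule that[rotated])
qed

text \<open>Choose \<open>z\<close> in the cone with \<open>S z = e\<^sub>0\<close>. A small step from \<open>x\<close> against \<open>z\<close> remains in the cone,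
  and \<open>S\<close> turns it into a step from \<open>S x\<close> down the time axis.\<close>
lemma automorphism_preserves_interior:
  assumes m: "m > 0" and S: "S \<in> cone_automorphisms (Suc m) (lorentz_cone (Suc m))"
    and x: "x \<in> lorentz_cone (Suc m)" "minkowski_form m x > 0"
  shows "minkowski_form m (S *\<^sub>v x) > 0"
proof -
  let ?C = "lorentz_cone (Suc m)"
  from S have Sc: "S \<in> carrier_mat (Suc m) (Suc m)"
    and SC: "(\<lambda>x. S *\<^sub>v x) ` ?C = ?C"
    by (auto simp: cone_automorphisms_def)
  obtain z where z: "z \<in> ?C" "S *\<^sub>v z = time_axis m"
    using SC time_axis_in_lorentz_cone[OF m] by (metis (no_types, lifting) imageE)
  have c: "x \<in> carrier_vec (Suc m)" "z \<in> carrier_vec (Suc m)"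
    using x z by (auto simp: lorentz_cone_def)
  obtain t where t: "t > 0" "x - t \<cdot>\<^sub>v z \<in> ?C"
    using interior_small_step[OF m x c(2)] by auto
  have "S *\<^sub>v (x - t \<cdot>\<^sub>v z) = S *\<^sub>v x - t \<cdot>\<^sub>v time_axis m"
    using c z(2) by (simp add: mult_minus_distrib_mat_vec[OF Sc] mult_mat_vec[OF Sc])
  moreover have "S *\<^sub>v (x - t \<cdot>\<^sub>v z) \<in> ?C"
    using t(2) SC by blast
  ultimately show ?thesis
    using m Sc c t(1) by (intro minkowski_form_pos_of_minus_axis[of _ _ t]) auto
qed

text \<open>If \<open>S x\<close> were interior, then applying the inverse automorphism would make \<open>x\<close> interior.\<close>
lemma automorphism_preserves_null:
  assumes m: "m > 0" and S: "S \<in> cone_automorphisms (Suc m) (lorentz_cone (Suc m))"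
    and x: "x \<in> lorentz_cone (Suc m)" "minkowski_form m x = 0"
  shows "minkowski_form m (S *\<^sub>v x) = 0"
proof (rule ccontr)
  assume ne: "minkowski_form m (S *\<^sub>v x) \<noteq> 0"
  from S have Sc: "S \<in> carrier_mat (Suc m) (Suc m)"
    and Sx: "S *\<^sub>v x \<in> lorentz_cone (Suc m)"
    using x(1) by (auto simp: cone_automorphisms_def)
  obtain R where R: "R \<in> cone_automorphisms (Suc m) (lorentz_cone (Suc m))"
    and RS: "R * S = 1\<^sub>m (Suc m)"
    using automorphism_inverse[OF m S] .
  from R have Rc: "R \<in> carrier_mat (Suc m) (Suc m)" by (simp add: cone_automorphisms_def)
  have xc: "x \<in> carrier_vec (Suc m)" using x(1) by (simp add: lorentz_cone_def)
  have "minkowski_form m (S *\<^sub>v x) > 0"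
    using ne Sx m by (simp add: lorentz_cone_iff)
  from automorphism_preserves_interior[OF m R Sx this]
  have "minkowski_form m (R *\<^sub>v (S *\<^sub>v x)) > 0" .
  moreover have "R *\<^sub>v (S *\<^sub>v x) = x"
    using xc by (simp add: RS flip: assoc_mult_mat_vec[OF Rc Sc])
  ultimately show False using x(2) by simp
qed

text \<open>Used both for the Minkowski matrix, to see that test vectors are null, and for the matrix
  whose form vanishes on them. The indices may coincide.\<close>
lemma quadratic_form_three_units:
  fixes M :: "real mat" and a b c :: real
  assumes M: "M \<in> carrier_mat n n" "i < n" "j < n" "k < n"
  defines "x \<equiv> a \<cdot>\<^sub>v unit_vec n i + (b \<cdot>\<^sub>v unit_vec n j + c \<cdot>\<^sub>v unit_vec n k)"
  shows "x \<bullet> (M *\<^sub>v x) =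
    a\<^sup>2 * M $$ (i, i) + b\<^sup>2 * M $$ (j, j) + c\<^sup>2 * M $$ (k, k)
    + a * b * (M $$ (i, j) + M $$ (j, i)) + a * c * (M $$ (i, k) + M $$ (k, i))
    + b * c * (M $$ (j, k) + M $$ (k, j))"
proof -
  have Mu: "M *\<^sub>v unit_vec n l \<in> carrier_vec n" for l
    using M(1) by (intro mult_mat_vec_carrier[of _ _ n]) auto
  have u: "unit_vec n p \<bullet> (M *\<^sub>v unit_vec n q) = M $$ (p, q)" if "p < n" "q < n" for p q
    using that M(1) Mu by (subst scalar_prod_left_unit[of _ n]) auto
  have "M *\<^sub>v x = a \<cdot>\<^sub>v (M *\<^sub>v unit_vec n i) +
      (b \<cdot>\<^sub>v (M *\<^sub>v unit_vec n j) + c \<cdot>\<^sub>v (M *\<^sub>v unit_vec n k))"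
    unfolding x_def
    by (simp add: mult_add_distrib_mat_vec[OF M(1)] mult_mat_vec[OF M(1)])
  then have "x \<bullet> (M *\<^sub>v x) = x \<bullet> (a \<cdot>\<^sub>v (M *\<^sub>v unit_vec n i)) +
      (x \<bullet> (b \<cdot>\<^sub>v (M *\<^sub>v unit_vec n j)) + x \<bullet> (c \<cdot>\<^sub>v (M *\<^sub>v unit_vec n k)))"
    using Mu by (simp add: scalar_prod_add_distrib[of _ n] x_def)
  moreover have "x \<bullet> (d \<cdot>\<^sub>v (M *\<^sub>v unit_vec n l)) =
      d * (a * M $$ (i, l) + (b * M $$ (j, l) + c * M $$ (k, l)))" if "l < n" for d l
  proof -
    have "x \<bullet> (M *\<^sub>v unit_vec n l) = a * M $$ (i, l) + (b * M $$ (j, l) + c * M $$ (k, l))"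
      unfolding x_def using Mu[of l] M that
      by (subst add_scalar_prod_distrib[of _ n]; (subst add_scalar_prod_distrib[of _ n])?)
        (auto simp: u simp del: scalar_prod_left_unit index_mult_mat_vec)
    then show ?thesis
      using Mu[of l] by (subst scalar_prod_smult_distrib[of _ n]) (auto simp: x_def)
  qed
  ultimately show ?thesis
    using M(2-4) by (simp add: algebra_simps power2_eq_square)
qed

lemma minkowski_index:
  assumes "i < Suc m" "j < Suc m"
  shows "minkowski m $$ (i, j) = (if i = j then if i = 0 then 1 else - 1 else 0)"
  using assms by (cases i; cases j) (auto simp: minkowski_def spatial_block_index)

text \<open>The null vectors \<open>e\<^sub>0 \<plusminus> e\<^sub>i\<close> give \<open>M\<^sub>0\<^sub>0 + M\<^sub>i\<^sub>i \<plusminus> 2 M\<^sub>0\<^sub>i = 0\<close>, which settles the mixed and the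
  diagonal entries. The null vector \<open>5 e\<^sub>0 + 4 e\<^sub>i + 3 e\<^sub>j\<close>, a Pythagorean triple, then isolates
  \<open>M\<^sub>i\<^sub>j\<close>.\<close>
lemma symmetric_vanishing_on_null_cone:
  assumes m: "m > 0" and M: "M \<in> carrier_mat (Suc m) (Suc m)" "transpose_mat M = M"
    and null: "\<And>x. x \<in> lorentz_cone (Suc m) \<Longrightarrow> minkowski_form m x = 0 \<Longrightarrow> x \<bullet> (M *\<^sub>v x) = 0"
  shows "M = M $$ (0, 0) \<cdot>\<^sub>m minkowski m"
proof -
  have sym: "M $$ (i, j) = M $$ (j, i)" if "i < Suc m" "j < Suc m" for i j
    using M that by (metis carrier_matD index_transpose_mat(1))
  have eq: "a\<^sup>2 * M $$ (0, 0) + b\<^sup>2 * M $$ (i, i) + c\<^sup>2 * M $$ (j, j)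
    + a * b * (2 * M $$ (0, i)) + a * c * (2 * M $$ (0, j)) + b * c * (2 * M $$ (i, j)) = 0"
    if ij: "0 < i" "i < Suc m" "0 < j" "j < Suc m" "i \<noteq> j \<or> c = 0"
      and abc: "0 \<le> a" "a\<^sup>2 = b\<^sup>2 + c\<^sup>2" for i j and a b c :: real
  proof -
    let ?x = "a \<cdot>\<^sub>v time_axis m + (b \<cdot>\<^sub>v unit_vec (Suc m) i + c \<cdot>\<^sub>v unit_vec (Suc m) j)"
    have form: "minkowski_form m ?x = 0"
      unfolding minkowski_form_def
      by (subst quadratic_form_three_units) (use ij abc in \<open>auto simp: minkowski_index\<close>)
    have "?x $ 0 = a" using ij by (auto simp: unit_vec_def)
    with form abc m have "?x \<in> lorentz_cone (Suc m)" by (simp add: lorentz_cone_iff)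
    from null[OF this form] show ?thesis
      by (subst (asm) quadratic_form_three_units) (use ij M sym[of i 0] sym[of j 0] sym[of j i] in auto)
  qed
  have mixed: "M $$ (0, i) = 0" and diag: "M $$ (i, i) = - M $$ (0, 0)" if "0 < i" "i < Suc m" for i
    using eq[of i i 0 1 1] eq[of i i 0 1 "-1"] that by auto
  have off: "M $$ (i, j) = 0" if "0 < i" "i < Suc m" "0 < j" "j < Suc m" "i \<noteq> j" for i j
    using eq[of i j 4 5 3] mixed[of i] mixed[of j] diag[of i] diag[of j] that by auto
  show ?thesis
  proof (rule eq_matI)
    fix i j assume "i < dim_row (M $$ (0, 0) \<cdot>\<^sub>m minkowski m)" "j < dim_col (M $$ (0, 0) \<cdot>\<^sub>m minkowski m)"
    then have ij: "i < Suc m" "j < Suc m" using carrier_matD[OF minkowski_carrier] by auto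
    show "M $$ (i, j) = (M $$ (0, 0) \<cdot>\<^sub>m minkowski m) $$ (i, j)"
      using ij mixed[of i] mixed[of j] diag[of i] off[of i j] sym[of i 0] carrier_matD[OF minkowski_carrier[of m]]
      by (cases "i = 0"; cases "j = 0") (auto simp: minkowski_index)
  qed (use M carrier_matD[OF minkowski_carrier[of m]] in auto)
qed

text \<open>With \<open>S\<^sup>T \<eta> S = \<mu> \<eta>\<close>, the factor \<open>\<mu>\<close> is the value of the form at the image of the time axis,
  an interior point; so it is positive and can be normalised away.\<close>
lemma automorphism_imp_smult_orthochronous:
  assumes m: "m > 0" and S: "S \<in> cone_automorphisms (Suc m) (lorentz_cone (Suc m))"
  obtains \<nu> L where "\<nu> > 0" "L \<in> orthochronous m" "S = \<nu> \<cdot>\<^sub>m L"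
proof -
  note e0 = time_axis_in_lorentz_cone[OF m]
  from S have Sc: "S \<in> carrier_mat (Suc m) (Suc m)"
    and Se0: "S *\<^sub>v time_axis m \<in> lorentz_cone (Suc m)"
    using e0 by (auto simp: cone_automorphisms_def)
  define M where "M = transpose_mat S * minkowski m * S"
  note carr = mult_carrier_mat[of _ "Suc m" "Suc m"] mult_smult_distrib[of _ "Suc m" "Suc m" _ "Suc m"]
      mult_smult_assoc_mat[of _ "Suc m" "Suc m" _ "Suc m"]
  have Mc: "M \<in> carrier_mat (Suc m) (Suc m)"
    using Sc by (simp add: M_def carr)
  have Msym: "transpose_mat M = M"
    using Sc by (simp add: M_def transpose_mult[of _ "Suc m" "Suc m" _ "Suc m"] carr
        minkowski_transpose assoc_mult_mat[of _ "Suc m" "Suc m" _ "Suc m" _ "Suc m"])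
  define \<mu> where "\<mu> = M $$ (0, 0)"
  have M: "M = \<mu> \<cdot>\<^sub>m minkowski m"
    unfolding \<mu>_def
  proof (rule symmetric_vanishing_on_null_cone[OF m Mc Msym])
    fix x assume x: "x \<in> lorentz_cone (Suc m)" "minkowski_form m x = 0"
    then have "x \<in> carrier_vec (Suc m)" by (simp add: lorentz_cone_def)
    then show "x \<bullet> (M *\<^sub>v x) = 0"
      using automorphism_preserves_null[OF m S x] by (simp only: minkowski_form_mult[OF Sc] M_def)
  qed
  have "0 < minkowski_form m (S *\<^sub>v time_axis m)"
    by (rule automorphism_preserves_interior[OF m S e0]) (simp add: minkowski_form_time_axis)
  also have "\<dots> = time_axis m \<bullet> (M *\<^sub>v time_axis m)"
    by (simp only: minkowski_form_mult[OF Sc unit_vec_carrier] M_def)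
  also have "\<dots> = \<mu>"
    using Mc by (subst scalar_prod_left_unit[of _ "Suc m"]) (auto simp: \<mu>_def)
  finally have mu: "\<mu> > 0" .
  define L where "L = (1 / sqrt \<mu>) \<cdot>\<^sub>m S"
  have Lc: "L \<in> carrier_mat (Suc m) (Suc m)" using Sc by (simp add: L_def)
  have tL: "transpose_mat L = (1 / sqrt \<mu>) \<cdot>\<^sub>m transpose_mat S"
    using Sc by (auto simp: L_def intro!: eq_matI)
  have "transpose_mat L * minkowski m * L = (1 / sqrt \<mu>) \<cdot>\<^sub>m ((1 / sqrt \<mu>) \<cdot>\<^sub>m M)"
    unfolding tL M_def using Sc by (simp add: L_def carr)
  also have "\<dots> = minkowski m"
    unfolding M using mu carrier_matD[OF minkowski_carrier[of m]] by (intro eq_matI) auto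
  finally have LG: "L \<in> lorentz_group m" using Lc by (simp add: lorentz_group_def)
  have "0 \<le> S $$ (0, 0)"
    using Se0 m Sc by (simp add: lorentz_cone_iff)
  then have "L \<in> orthochronous m"
    using orthochronous_iff[OF m LG] Sc mu by (simp add: L_def)
  moreover have "S = sqrt \<mu> \<cdot>\<^sub>m L"
    using mu Sc by (intro eq_matI) (auto simp: L_def)
  ultimately show thesis using mu by (intro that[of "sqrt \<mu>" L]) auto
qed

section \<open>Boosts, rotations and the polar decomposition\<close>

text \<open>In block form the Lorentz equation for \<open>diag(1, U)\<close> reads \<open>- U\<^sup>T U = - 1\<close>.\<close>
lemma spatial_block_in_orthochronous_iff:
  assumes m: "m > 0" and U: "U \<in> carrier_mat m m"
  shows "spatial_block m U \<in> orthochronous m \<longleftrightarrow> U \<in> orthogonal_group m"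
proof -
  have "spatial_block m U \<in> orthochronous m \<longleftrightarrow> spatial_block m U \<in> lorentz_group m"
    using spatial_block_index(1)[OF U] orthochronous_iff[OF m, of "spatial_block m U"]
    by (auto simp: orthochronous_def)
  also have "\<dots> \<longleftrightarrow> spatial_block m (transpose_mat U * - 1\<^sub>m m * U) = spatial_block m (- 1\<^sub>m m)"
    using U by (simp add: lorentz_group_def minkowski_def spatial_block_transpose
        spatial_block_mult mult_carrier_mat[of _ m m])
  also have "\<dots> \<longleftrightarrow> transpose_mat U * - 1\<^sub>m m * U = - 1\<^sub>m m"
    using U by (auto dest!: spatial_block_inject[rotated 2])
  also have "transpose_mat U * - 1\<^sub>m m * U = - (transpose_mat U * U)"
    using U by (simp add: right_mult_one_mat[of _ m m])
  also have "- (transpose_mat U * U) = - 1\<^sub>m m \<longleftrightarrow> transpose_mat U * U = 1\<^sub>m m"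
    by (metis uminus_uminus_mat)
  also have "\<dots> \<longleftrightarrow> U \<in> orthogonal_group m"
    using U mat_mult_left_right_inverse[of "transpose_mat U" m U] by (auto simp: orthogonal_group_def)
  finally show ?thesis .
qed

lemma orthogonal_group_transpose: "U \<in> orthogonal_group m \<Longrightarrow> transpose_mat U \<in> orthogonal_group m"
  by (simp add: orthogonal_group_def)

lemma lorentz_boost_eq:
  "lorentz_boost (Suc (Suc k)) \<alpha> = four_block_mat
    (mat_of_rows_list 2 [[sqrt (1 + \<alpha>\<^sup>2), \<alpha>], [\<alpha>, sqrt (1 + \<alpha>\<^sup>2)]]) (0\<^sub>m 2 k) (0\<^sub>m k 2) (1\<^sub>m k)"
  by (simp only: lorentz_boost_def diag_block_mat_pair) (simp add: mat_of_rows_list_def numeral_2_eq_2)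

text \<open>After regrouping \<open>\<eta>\<close> into blocks of sizes \<open>2\<close> and \<open>k\<close>, only the upper block matters, and there
  the equation is \<open>(1 + \<alpha>\<^sup>2) - \<alpha>\<^sup>2 = 1\<close>.\<close>
lemma lorentz_boost_orthochronous: "lorentz_boost (Suc (Suc k)) \<alpha> \<in> orthochronous (Suc k)"
proof -
  let ?G = "mat_of_rows_list 2 [[sqrt (1 + \<alpha>\<^sup>2), \<alpha>], [\<alpha>, sqrt (1 + \<alpha>\<^sup>2)]]"
  let ?H = "mat_of_rows_list 2 [[1, 0], [0, - 1 :: real]]"
  have G: "?G \<in> carrier_mat 2 2" and H: "?H \<in> carrier_mat 2 2"
    by (auto simp: mat_of_rows_list_def)
  have eta: "minkowski (Suc k) = four_block_mat ?H (0\<^sub>m 2 k) (0\<^sub>m k 2) (- 1\<^sub>m k)"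
    using H carrier_matD[OF minkowski_carrier[of "Suc k"]]
    by (intro eq_matI) (auto simp: minkowski_index mat_of_rows_list_def less_2_cases_iff)
  have "sqrt (1 + \<alpha>\<^sup>2) * sqrt (1 + \<alpha>\<^sup>2) = 1 + \<alpha>\<^sup>2"
    by (simp add: power2_eq_square flip: real_sqrt_mult)
  then have GHG: "transpose_mat ?G * ?H * ?G = ?H"
    by (intro eq_matI)
      (auto simp: mat_of_rows_list_def less_Suc_eq scalar_prod_def numeral_2_eq_2 power2_eq_square)
  have "transpose_mat (lorentz_boost (Suc (Suc k)) \<alpha>)
      = four_block_mat (transpose_mat ?G) (0\<^sub>m 2 k) (0\<^sub>m k 2) (1\<^sub>m k)"
    unfolding lorentz_boost_eq by (subst transpose_four_block_mat[OF G]) auto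
  moreover have "- 0\<^sub>m 2 k = (0\<^sub>m 2 k :: real mat)"
    by (intro eq_matI) auto
  ultimately have "transpose_mat (lorentz_boost (Suc (Suc k)) \<alpha>) * minkowski (Suc k)
      * lorentz_boost (Suc (Suc k)) \<alpha> = four_block_mat (transpose_mat ?G * ?H * ?G) (0\<^sub>m 2 k) (0\<^sub>m k 2) (- 1\<^sub>m k)"
    unfolding lorentz_boost_eq eta using G H
    by (simp add: mult_four_block_mat[of _ 2 2 _ k _ k _ _ 2 _ k] mult_carrier_mat[of _ 2 2]
        left_add_zero_mat[of _ 2 2] right_add_zero_mat[of _ 2 2] left_mult_one_mat[of _ k k] right_mult_one_mat[of _ k k])
  moreover have "lorentz_boost (Suc (Suc k)) \<alpha> \<in> carrier_mat (Suc (Suc k)) (Suc (Suc k))"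
    unfolding lorentz_boost_eq using G by auto
  ultimately have "lorentz_boost (Suc (Suc k)) \<alpha> \<in> lorentz_group (Suc k)"
    unfolding GHG eta[symmetric] by (simp add: lorentz_group_def)
  moreover have "lorentz_boost (Suc (Suc k)) \<alpha> $$ (0, 0) = sqrt (1 + \<alpha>\<^sup>2)"
    unfolding lorentz_boost_eq by (simp add: mat_of_rows_list_def)
  ultimately show ?thesis
    by (simp add: orthochronous_iff)
qed

lemma lorentz_boost_time_axis:
  "lorentz_boost (Suc (Suc k)) \<alpha> *\<^sub>v time_axis (Suc k)
    = vCons (sqrt (1 + \<alpha>\<^sup>2)) (\<alpha> \<cdot>\<^sub>v unit_vec (Suc k) 0)"
proof -
  have "lorentz_boost (Suc (Suc k)) \<alpha> *\<^sub>v time_axis (Suc k) = col (lorentz_boost (Suc (Suc k)) \<alpha>) 0"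
    by (intro eq_vecI) (auto simp: lorentz_boost_eq mat_of_rows_list_def)
  also have "\<dots> = vCons (sqrt (1 + \<alpha>\<^sup>2)) (\<alpha> \<cdot>\<^sub>v unit_vec (Suc k) 0)"
    by (intro eq_vecI)
      (auto simp: lorentz_boost_eq mat_of_rows_list_def vec_index_vCons unit_vec_def less_2_cases_iff)
  finally show ?thesis .
qed

text \<open>The Householder reflection in the hyperplane orthogonal to \<open>w = x - y\<close> exchanges \<open>x\<close> and \<open>y\<close>
  when they have equal length, because then \<open>w \<bullet> w = 2 (w \<bullet> x)\<close>.\<close>
lemma orthogonal_transitive_on_spheres:
  assumes xy: "x \<in> carrier_vec m" "y \<in> carrier_vec m" "x \<bullet> x = y \<bullet> y"
  obtains V where "V \<in> orthogonal_group m" "V *\<^sub>v x = (y :: real vec)"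
proof (cases "x = y")
  case True
  with xy show thesis by (intro that[of "1\<^sub>m m"]) (auto simp: orthogonal_group_def)
next
  case False
  define w where "w = x - y"
  have w: "w \<in> carrier_vec m" using xy by (simp add: w_def)
  have xy': "x \<bullet> y = y \<bullet> x" using xy by (intro comm_scalar_prod)
  have ww: "w \<bullet> w = 2 * (w \<bullet> x)"
    unfolding w_def using xy xy'
    by (simp add: minus_scalar_prod_distrib[of _ m] scalar_prod_minus_distrib[of _ m])
  have "w \<bullet> w \<noteq> 0"
  proof
    assume "w \<bullet> w = 0"
    then have "\<forall>i<m. w $ i = 0"
      using w by (auto simp: scalar_prod_self_eq_sum sum_nonneg_eq_0_iff)
    with xy False show False by (auto simp: w_def intro!: eq_vecI)
  qed
  \<comment> \<open>The reflection \<open>1 - 2 w w\<^sup>T / (w \<bullet> w)\<close>.\<close>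
  define V where "V = mat m m (\<lambda>(i, j). (if i = j then 1 else 0) - 2 / (w \<bullet> w) * w $ i * w $ j)"
  have Vc: "V \<in> carrier_mat m m" by (simp add: V_def)
  have V: "V *\<^sub>v z = z - (2 / (w \<bullet> w) * (w \<bullet> z)) \<cdot>\<^sub>v w" if z: "z \<in> carrier_vec m" for z
  proof (rule eq_vecI)
    fix i assume "i < dim_vec (z - (2 / (w \<bullet> w) * (w \<bullet> z)) \<cdot>\<^sub>v w)"
    then have i: "i < m" using w by simp
    have "(V *\<^sub>v z) $ i = (\<Sum>j<m. (if i = j then z $ j else 0) - 2 / (w \<bullet> w) * w $ i * (w $ j * z $ j))"
      using i z by (auto simp: V_def scalar_prod_def atLeast0LessThan algebra_simps intro!: sum.cong)
    also have "\<dots> = z $ i - 2 / (w \<bullet> w) * w $ i * (w \<bullet> z)"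
      using i z w by (simp add: sum_subtractf scalar_prod_def[of w z] atLeast0LessThan sum_distrib_left)
    finally show "(V *\<^sub>v z) $ i = (z - (2 / (w \<bullet> w) * (w \<bullet> z)) \<cdot>\<^sub>v w) $ i"
      using i z w by (simp add: ac_simps)
  qed (use w Vc in auto)
  have sym: "transpose_mat V = V"
    by (intro eq_matI) (auto simp: V_def)
  have invol: "V *\<^sub>v (V *\<^sub>v z) = z" if z: "z \<in> carrier_vec m" for z
  proof -
    let ?c = "2 / (w \<bullet> w) * (w \<bullet> z)"
    have "w \<bullet> (z - ?c \<cdot>\<^sub>v w) = - (w \<bullet> z)"
      using w z \<open>w \<bullet> w \<noteq> 0\<close> by (simp add: scalar_prod_minus_distrib[of _ m])
    then have "V *\<^sub>v (V *\<^sub>v z) = (z - ?c \<cdot>\<^sub>v w) - (- ?c) \<cdot>\<^sub>v w"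
      using w z V[OF z] V[of "z - ?c \<cdot>\<^sub>v w"] by simp
    also have "\<dots> = z" using w z by (intro eq_vecI) auto
    finally show ?thesis .
  qed
  have "V * V = 1\<^sub>m m"
  proof (rule mat_col_eqI)
    fix j assume "j < dim_col (1\<^sub>m m :: real mat)"
    then have j: "j < m" by simp
    have "V *\<^sub>v unit_vec m j = col V j"
      using Vc j by (intro eq_vecI) auto
    then have "col (V * V) j = V *\<^sub>v (V *\<^sub>v unit_vec m j)"
      by (simp add: col_mult2[OF Vc Vc j])
    with invol j show "col (V * V) j = col (1\<^sub>m m) j" by simp
  qed (use Vc in auto)
  then have "V \<in> orthogonal_group m"
    using Vc by (simp add: orthogonal_group_def sym)
  moreover have "V *\<^sub>v x = y"
    using V[OF xy(1)] ww \<open>w \<bullet> w \<noteq> 0\<close> xy by (auto simp: w_def intro!: eq_vecI)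
  ultimately show thesis by (rule that)
qed

text \<open>From \<open>T e\<^sub>0 = e\<^sub>0\<close> and \<open>T\<^sup>T \<eta> T = \<eta>\<close> one gets \<open>T\<^sup>T e\<^sub>0 = T\<^sup>T \<eta> T e\<^sub>0 = e\<^sub>0\<close>. So not only the first
  column but also the first row of \<open>T\<close> is trivial, and \<open>T\<close> is block diagonal.\<close>
lemma lorentz_fixing_time_axis:
  assumes m: "m > 0" and T: "T \<in> orthochronous m" and fix_e0: "T *\<^sub>v time_axis m = time_axis m"
  obtains U where "U \<in> orthogonal_group m" "T = spatial_block m U"
proof -
  let ?\<eta> = "minkowski m"
  from T have TG: "T \<in> lorentz_group m" by (simp add: orthochronous_def)
  note Tc = lorentz_group_carrier[OF TG]
  have \<eta>: "?\<eta> *\<^sub>v time_axis m = time_axis m"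
    unfolding minkowski_def by (rule spatial_block_time_axis) simp
  have "transpose_mat T *\<^sub>v time_axis m = transpose_mat T *\<^sub>v (?\<eta> *\<^sub>v (T *\<^sub>v time_axis m))"
    by (simp only: fix_e0 \<eta>)
  also have "\<dots> = (transpose_mat T * ?\<eta> * T) *\<^sub>v time_axis m"
    using Tc by (subst assoc_mult_mat_vec[of _ "Suc m" "Suc m" _ "Suc m"], auto)+
  also have "\<dots> = time_axis m"
    using TG \<eta> by (simp add: lorentz_group_def)
  finally have fix_e0': "transpose_mat T *\<^sub>v time_axis m = time_axis m" .
  define U where "U = mat m m (\<lambda>(i, j). T $$ (Suc i, Suc j))"
  have Uc: "U \<in> carrier_mat m m" by (simp add: U_def)
  have col0: "T $$ (i, 0) = time_axis m $ i" if "i < Suc m" for i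
    using mult_unit_vec_index[OF Tc that, of 0] fix_e0 by simp
  have row0: "T $$ (0, i) = time_axis m $ i" if "i < Suc m" for i
    using mult_unit_vec_index[of "transpose_mat T" "Suc m" i 0] that Tc fix_e0' by simp
  have "T = spatial_block m U"
  proof (rule eq_matI)
    fix i j assume "i < dim_row (spatial_block m U)" "j < dim_col (spatial_block m U)"
    then have "i < Suc m" "j < Suc m" using carrier_matD[OF spatial_block_carrier[OF Uc]] by auto
    then show "T $$ (i, j) = spatial_block m U $$ (i, j)"
      using col0[of i] row0[of j] spatial_block_index[OF Uc]
      by (cases i; cases j) (auto simp: U_def)
  qed (use carrier_matD[OF spatial_block_carrier[OF Uc]] Tc in auto)
  with T have "U \<in> orthogonal_group m"
    using spatial_block_in_orthochronous_iff[OF m Uc] by simp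
  then show thesis using \<open>T = spatial_block m U\<close> by (rule that)
qed

definition rotated_boost :: "nat \<Rightarrow> real \<Rightarrow> real mat \<Rightarrow> real mat" where
  "rotated_boost m \<alpha> V =
     spatial_block m V * lorentz_boost (Suc m) \<alpha> * spatial_block m (transpose_mat V)"

lemma rotated_boost_orthochronous:
  assumes "m > 0" "V \<in> orthogonal_group m"
  shows "rotated_boost m \<alpha> V \<in> orthochronous m"
proof -
  from assms(1) obtain k where "m = Suc k" by (cases m) auto
  then have "lorentz_boost (Suc m) \<alpha> \<in> orthochronous m"
    by (simp add: lorentz_boost_orthochronous)
  moreover have "V \<in> carrier_mat m m" using assms by (simp add: orthogonal_group_def)
  ultimately show ?thesis
    unfolding rotated_boost_def using assms
    by (intro orthochronous_mult spatial_block_in_orthochronous_iff[THEN iffD2]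
        orthogonal_group_transpose) auto
qed

text \<open>An orthochronous matrix is determined up to a rotation or reflection on the right by the image of
  the time axis, a point of the sheet \<open>x\<^sub>0 > 0\<close> of the hyperboloid \<open>q = 1\<close>; conjugated boosts reach every
  point of that sheet.\<close>
lemma polar_decomposition_orthochronous:
  assumes m: "m > 0" and L: "L \<in> orthochronous m"
  obtains \<alpha> U V where "\<alpha> \<ge> 0" "U \<in> orthogonal_group m" "V \<in> orthogonal_group m"
    "L = rotated_boost m \<alpha> V * spatial_block m U"
proof -
  from m obtain k where k: "m = Suc k" by (cases m) auto
  from L have LG: "L \<in> lorentz_group m" by (simp add: orthochronous_def)
  note Lc = lorentz_group_carrier[OF LG]
  have Le0: "L *\<^sub>v time_axis m \<in> lorentz_cone (Suc m)" using L by (simp add: orthochronous_def)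
  then obtain a b where ab: "L *\<^sub>v time_axis m = vCons a b" "b \<in> carrier_vec m"
    using vCons_cases_carrier[of "L *\<^sub>v time_axis m" m] by (auto simp: lorentz_cone_def)
  have a: "a \<ge> 0" using Le0 m by (simp add: ab lorentz_cone_iff)
  have "minkowski_form m (L *\<^sub>v time_axis m) = 1"
    using minkowski_form_lorentz[OF LG unit_vec_carrier] by (simp only: minkowski_form_time_axis)
  then have a2: "a\<^sup>2 = 1 + b \<bullet> b" by (simp add: ab minkowski_form_vCons)
  have bb: "b \<bullet> b \<ge> 0" using ab by (simp add: scalar_prod_self_eq_sum sum_nonneg)
  define \<alpha> where "\<alpha> = sqrt (b \<bullet> b)"
  have \<alpha>: "\<alpha> \<ge> 0" "\<alpha>\<^sup>2 = b \<bullet> b" using bb by (auto simp: \<alpha>_def)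
  have a_eq: "a = sqrt (1 + \<alpha>\<^sup>2)" using a a2 \<alpha> by (metis real_sqrt_unique)
  have "(\<alpha> \<cdot>\<^sub>v unit_vec m 0) \<bullet> (\<alpha> \<cdot>\<^sub>v unit_vec m 0) = b \<bullet> b"
    using m \<alpha>(2) by (simp add: power2_eq_square)
  then obtain V where V: "V \<in> orthogonal_group m" "V *\<^sub>v (\<alpha> \<cdot>\<^sub>v unit_vec m 0) = b"
    using orthogonal_transitive_on_spheres[of "\<alpha> \<cdot>\<^sub>v unit_vec m 0" m b] ab(2) by auto
  then have Vc: "V \<in> carrier_mat m m" by (simp add: orthogonal_group_def)
  define P where "P = rotated_boost m \<alpha> V"
  have P: "P \<in> orthochronous m" unfolding P_def using m V(1) by (rule rotated_boost_orthochronous)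
  then have PG: "P \<in> lorentz_group m" by (simp add: orthochronous_def)
  note Pc = lorentz_group_carrier[OF PG]
  note Ic = lorentz_inverse_carrier[OF Pc]
  have Bc: "lorentz_boost (Suc m) \<alpha> \<in> carrier_mat (Suc m) (Suc m)"
    using lorentz_boost_orthochronous[of k \<alpha>] by (auto simp: k orthochronous_def lorentz_group_def)
  have "P *\<^sub>v time_axis m = spatial_block m V *\<^sub>v
      (lorentz_boost (Suc m) \<alpha> *\<^sub>v (spatial_block m (transpose_mat V) *\<^sub>v time_axis m))"
    unfolding P_def rotated_boost_def using Vc Bc
    by (simp add: mult_carrier_mat[of _ "Suc m" "Suc m"] mult_mat_vec_carrier[of _ "Suc m" "Suc m"]
        assoc_mult_mat_vec[of _ "Suc m" "Suc m" _ "Suc m"])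
  also have "\<dots> = spatial_block m V *\<^sub>v vCons (sqrt (1 + \<alpha>\<^sup>2)) (\<alpha> \<cdot>\<^sub>v unit_vec m 0)"
    using Vc lorentz_boost_time_axis[of k \<alpha>] by (simp add: spatial_block_time_axis k)
  also have "\<dots> = L *\<^sub>v time_axis m"
    using Vc V(2) by (simp add: spatial_block_mult_vec ab(1) a_eq)
  finally have PL: "P *\<^sub>v time_axis m = L *\<^sub>v time_axis m" .
  \<comment> \<open>\<open>P\<close> and \<open>L\<close> agree on the time axis, so \<open>P\<^sup>-\<^sup>1 L\<close> fixes it.\<close>
  define T where "T = lorentz_inverse m P * L"
  have "T \<in> orthochronous m"
    unfolding T_def using m P L by (intro orthochronous_mult orthochronous_inverse)
  moreover have "T *\<^sub>v time_axis m = time_axis m"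
  proof -
    have "T *\<^sub>v time_axis m = lorentz_inverse m P *\<^sub>v (P *\<^sub>v time_axis m)"
      unfolding T_def PL using Ic Lc by (intro assoc_mult_mat_vec) auto
    also have "\<dots> = (lorentz_inverse m P * P) *\<^sub>v time_axis m"
      using Ic Pc by (intro assoc_mult_mat_vec[symmetric]) auto
    finally show ?thesis by (simp add: lorentz_inverse_mult[OF PG])
  qed
  ultimately obtain U where U: "U \<in> orthogonal_group m" "T = spatial_block m U"
    using lorentz_fixing_time_axis[OF m] by blast
  have "P * T = P * lorentz_inverse m P * L"
    unfolding T_def using Pc Ic Lc by (intro assoc_mult_mat[symmetric])
  also have "\<dots> = L"
    using Lc by (simp add: lorentz_inverse_mult[OF PG])
  finally have "L = rotated_boost m \<alpha> V * spatial_block m U"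
    by (simp add: U(2) P_def)
  with \<alpha>(1) U(1) V(1) show thesis by (rule that)
qed

theorem theorem1:
  fixes n :: nat and S :: "real mat"
  assumes "n > 1" and "S \<in> carrier_mat n n"
  shows "S \<in> cone_automorphisms n (lorentz_cone n) \<longleftrightarrow>
    (\<exists>\<nu> > 0. \<exists>\<alpha> \<ge> 0. \<exists>U \<in> orthogonal_group (n - 1). \<exists>V \<in> orthogonal_group (n - 1).
       S = \<nu> \<cdot>\<^sub>m (diag_block_mat [1\<^sub>m 1, V] * lorentz_boost n \<alpha> *
                diag_block_mat [1\<^sub>m 1, transpose_mat V] * diag_block_mat [1\<^sub>m 1, U]))"
proof -
  define m where "m = n - 1"
  have m: "m > 0" "n - 1 = m" and n: "n = Suc m" using assms(1) by (auto simp: m_def)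
  have block: "diag_block_mat [1\<^sub>m 1, V] * lorentz_boost n \<alpha> *
      diag_block_mat [1\<^sub>m 1, transpose_mat V] * diag_block_mat [1\<^sub>m 1, U]
      = rotated_boost m \<alpha> V * spatial_block m U"
    if "U \<in> orthogonal_group m" "V \<in> orthogonal_group m" for U V \<alpha>
  proof -
    from that have "U \<in> carrier_mat m m" "V \<in> carrier_mat m m" "transpose_mat V \<in> carrier_mat m m"
      by (auto simp: orthogonal_group_def)
    then show ?thesis
      by (simp only: diag_block_mat_eq_spatial_block rotated_boost_def n)
  qed
  show ?thesis
  proof
    assume "S \<in> cone_automorphisms n (lorentz_cone n)"
    then obtain \<nu> L where L: "\<nu> > 0" "L \<in> orthochronous m" "S = \<nu> \<cdot>\<^sub>m L"
      using automorphism_imp_smult_orthochronous[OF m(1)] unfolding n by blast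
    obtain \<alpha> U V where "\<alpha> \<ge> 0" "U \<in> orthogonal_group m" "V \<in> orthogonal_group m"
      "L = rotated_boost m \<alpha> V * spatial_block m U"
      using polar_decomposition_orthochronous[OF m(1) L(2)] .
    with L show "\<exists>\<nu> > 0. \<exists>\<alpha> \<ge> 0. \<exists>U \<in> orthogonal_group (n - 1). \<exists>V \<in> orthogonal_group (n - 1).
       S = \<nu> \<cdot>\<^sub>m (diag_block_mat [1\<^sub>m 1, V] * lorentz_boost n \<alpha> *
                diag_block_mat [1\<^sub>m 1, transpose_mat V] * diag_block_mat [1\<^sub>m 1, U])"
      unfolding m(2) using block by metis
  next
    assume "\<exists>\<nu> > 0. \<exists>\<alpha> \<ge> 0. \<exists>U \<in> orthogonal_group (n - 1). \<exists>V \<in> orthogonal_group (n - 1).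
       S = \<nu> \<cdot>\<^sub>m (diag_block_mat [1\<^sub>m 1, V] * lorentz_boost n \<alpha> *
                diag_block_mat [1\<^sub>m 1, transpose_mat V] * diag_block_mat [1\<^sub>m 1, U])"
    then obtain \<nu> \<alpha> U V where *: "\<nu> > 0" "U \<in> orthogonal_group m" "V \<in> orthogonal_group m"
      and S: "S = \<nu> \<cdot>\<^sub>m (rotated_boost m \<alpha> V * spatial_block m U)"
      unfolding m(2) using block by metis
    have "U \<in> carrier_mat m m" using * by (simp add: orthogonal_group_def)
    with m * show "S \<in> cone_automorphisms n (lorentz_cone n)"
      unfolding S n
      by (intro smult_orthochronous_automorphism orthochronous_mult rotated_boost_orthochronous
          spatial_block_in_orthochronous_iff[THEN iffD2])
  qed
qed

end
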